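(* Let $\lambda$ be a nonzero real number. For every integer $n\ge0$, \[ (x)_n=\sum_{m=0}^{n}G_{m,\lambda}(x)\,S_{2,\lambda}(n,m), \] and, for $x=1$, $(1)_n=\sum_{m=0}^{n}G_{m,\lambda}S_{2,\lambda}(n,m)$.
   Context: $(x)_0=1$ and $(x)_n=x(x-1)\cdots(x-n+1)$ for $n\ge1$ (falling factorial). For a nonzero real $\lambda$, set $(x)_{0,\lambda}=1$ and $(x)_{n,\lambda}=x(x-\lambda)\cdots(x-(n-1)\lambda)$ for $n\ge1$. Let $e_\lambda^x(t)=\sum_{n\ge0}(x)_{n,\lambda}\frac{t^n}{n!}=(1+\lambda t)^{x/\lambda}$, $e_\lambda(t)=e_\lambda^1(t)$, and $\log_\lambda(1+t)=\frac{1}{\lambda}((1+t)^\lambda-1)$. The degenerate Stirling numbers of the second kind are defined by $\frac{1}{k!}(e_\lambda(t)-1)^k=\sum_{n\ge k}S_{2,\lambda}(n,k)\frac{t^n}{n!}$. The Gaenari polynomials are defined by $e_\lambda^x\big(\log_\lambda(\log_\lambda(1+t)+1)\big)=\sum_{n\ge0}G_{n,\lambda}(x)\frac{t^n}{n!}$, with $G_{n,\lambda}=G_{n,\lambda}(1)$. *)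

theory Defs
  imports Complex_Main "HOL-Computational_Algebra.Formal_Power_Series"
begin

definition falling_fact :: "real \<Rightarrow> nat \<Rightarrow> real"
  where "falling_fact x n = (\<Prod>i<n. x - of_nat i)"

definition degen_falling_fact :: "real \<Rightarrow> real \<Rightarrow> nat \<Rightarrow> real"
  where "degen_falling_fact l x n = (\<Prod>i<n. x - of_nat i * l)"

definition degen_exp :: "real \<Rightarrow> real \<Rightarrow> real fps"
  where "degen_exp l x = Abs_fps (\<lambda>n. degen_falling_fact l x n / fact n)"

text \<open>The series of \<open>log\<^sub>\<lambda>(1 + t)\<close> in \<open>t\<close>; \<^term>\<open>fps_binomial l\<close> is \<open>(1 + t)\<^sup>\<lambda>\<close>.\<close>
definition degen_log1p :: "real \<Rightarrow> real fps"
  where "degen_log1p l = fps_const (1 / l) * (fps_binomial l - 1)"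

definition degen_Stirling2 :: "real \<Rightarrow> nat \<Rightarrow> nat \<Rightarrow> real"
  where "degen_Stirling2 l n k =
    fact n * fps_nth (fps_const (1 / fact k) * (degen_exp l 1 - 1) ^ k) n"

text \<open>Since \<^term>\<open>degen_log1p l\<close> is a series in \<open>t\<close> for \<open>log\<^sub>\<lambda>(1 + t)\<close>, the series of
  \<open>log\<^sub>\<lambda>(log\<^sub>\<lambda>(1 + t) + 1)\<close> is its composition with itself.\<close>
definition Gaenari_poly :: "real \<Rightarrow> nat \<Rightarrow> real \<Rightarrow> real"
  where "Gaenari_poly l n x =
    fact n * fps_nth (degen_exp l x oo (degen_log1p l oo degen_log1p l)) n"

definition Gaenari_number :: "real \<Rightarrow> nat \<Rightarrow> real"
  where "Gaenari_number l n = Gaenari_poly l n 1"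

lemma degen_exp_eq_binomial:
  assumes "l \<noteq> 0"
  shows "degen_exp l x = fps_binomial (x / l) oo (fps_const l * fps_X)"
proof (rule fps_ext)
  fix n
  have "(\<Prod>i<n. x - of_nat i * l) = (\<Prod>i<n. l * (x / l - of_nat i))"
    using assms by (intro prod.cong) (auto simp: field_simps)
  also have "\<dots> = l ^ n * (\<Prod>i<n. x / l - of_nat i)"
    by (simp add: prod.distrib)
  finally show "fps_nth (degen_exp l x) n =
      fps_nth (fps_binomial (x / l) oo (fps_const l * fps_X)) n"
    by (simp add: degen_exp_def degen_falling_fact_def fps_compose_linear
        gbinomial_prod_rev lessThan_atLeast0)
qed

text \<open>Compositions of formal power series are meaningful only if the inner series has
  constant term \<open>0\<close>.\<close>
lemma degen_log1p_nth_0: "fps_nth (degen_log1p l) 0 = 0"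
  by (simp add: degen_log1p_def)

lemma degen_exp_nth_0: "fps_nth (degen_exp l x) 0 = 1"
  by (simp add: degen_exp_def degen_falling_fact_def)

lemma degen_Stirling2_egf:
  "fps_const (1 / fact k) * (degen_exp l 1 - 1) ^ k =
    Abs_fps (\<lambda>n. degen_Stirling2 l n k / fact n)"
  by (rule fps_ext) (simp add: degen_Stirling2_def)

lemma degen_Stirling2_eq_0: "n < k \<Longrightarrow> degen_Stirling2 l n k = 0"
  by (simp add: degen_Stirling2_def startsby_zero_power_prefix degen_exp_nth_0)

lemma Gaenari_poly_egf:
  "degen_exp l x oo (degen_log1p l oo degen_log1p l) =
    Abs_fps (\<lambda>n. Gaenari_poly l n x / fact n)"
  by (rule fps_ext) (simp add: Gaenari_poly_def)

end

theory Submission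
  imports Defs
begin

text \<open>
  The series \<open>e\<^sub>\<lambda>(t) - 1\<close> is a right compositional inverse of \<open>log\<^sub>\<lambda>(1 + t)\<close>. Substituting it for
  \<open>t\<close> in the generating function of the Gaenari polynomials therefore cancels the inner logarithm
  and leaves \<open>e\<^sub>\<lambda>\<^sup>x(log\<^sub>\<lambda>(1 + t)) = (1 + t)\<^sup>x\<close>; the claim compares coefficients. Both cancellations
  are instances of the power law \<open>((1 + t)\<^sup>b)\<^sup>a = (1 + t)\<^sup>a\<^sup>b\<close>, which holds because both sides solve
  the differential equation \<open>(1 + t) F' = a b F\<close>.
\<close>

text \<open>Clearing the denominator leaves only sums and products, through which substitution of a
  series distributes.\<close>

lemma fps_binomial_deriv_mult:
  "(1 + fps_X) * fps_deriv (fps_binomial c) = fps_const c * fps_binomial (c::'a::field_char_0)"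
proof -
  have "fps_deriv (fps_binomial c) = fps_const c * fps_binomial c / (1 + fps_X)"
    by (rule fps_binomial_deriv)
  then show ?thesis
    by (simp add: fps_divide_unit mult.assoc mult.left_commute inverse_mult_eq_1')
qed

lemma fps_binomial_compose_binomial:
  fixes a b :: "'a::field_char_0"
  shows "fps_binomial a oo (fps_binomial b - 1) = fps_binomial (a * b)"
proof -
  define u where "u = fps_binomial b - 1"
  define F where "F = fps_binomial a oo u"
  define D where "D = fps_deriv (fps_binomial a) oo u"
  have u0: "fps_nth u 0 = 0" by (simp add: u_def)
  have "(1 + fps_X) * fps_deriv (fps_binomial a) oo u = fps_const a * fps_binomial a oo u"
    by (simp only: fps_binomial_deriv_mult)
  \<comment> \<open>Substituting \<open>u\<close> turns \<open>1 + fps_X\<close> into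
    \<open>1 + u\<close>, which is \<open>fps_binomial b\<close>.\<close>
  then have D: "fps_binomial b * D = fps_const a * F"
    using u0 by (simp add: fps_compose_mult_distrib fps_compose_add_distrib D_def F_def)
      (simp add: u_def)
  have "fps_deriv F = D * fps_deriv (fps_binomial b)"
    unfolding F_def D_def by (subst fps_compose_deriv[OF u0]) (simp add: u_def)
  \<comment> \<open>The factor \<open>1 + fps_X\<close> brings in the differential equation of the
    inner series; the leftover \<open>fps_binomial b * D\<close> is then given by
    \<open>D\<close>.\<close>
  then have "(1 + fps_X) * fps_deriv F = D * ((1 + fps_X) * fps_deriv (fps_binomial b))"
    by (simp add: mult_ac)
  also have "\<dots> = fps_const b * (fps_binomial b * D)"
    by (simp only: fps_binomial_deriv_mult) (simp only: mult_ac)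
  also have "\<dots> = fps_const (a * b) * F"
    by (simp only: D mult.assoc[symmetric] fps_const_mult) (simp only: mult.commute)
  finally have "(1 + fps_X) * fps_deriv F = fps_const (a * b) * F" .
  moreover have "1 + fps_X \<noteq> (0 :: 'a fps)"
    by (rule fps_nonzeroI[of _ 0]) simp
  ultimately have "fps_deriv F = fps_const (a * b) * F / (1 + fps_X)"
    by (metis nonzero_mult_div_cancel_left)
  moreover have "fps_nth F 0 = 1" by (simp add: F_def)
  ultimately have "F = fps_binomial (a * b)"
    using fps_binomial_ODE_unique' by blast
  then show ?thesis by (simp add: F_def u_def)
qed

text \<open>Scaling the logarithm by \<open>l\<close> gives \<open>fps_binomial l - 1\<close>, so
  the power law applies with exponents \<open>x / l\<close> and \<open>l\<close>.\<close>

lemma degen_exp_compose_log1p: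
  assumes "l \<noteq> 0"
  shows "degen_exp l x oo degen_log1p l = fps_binomial x"
proof -
  have "degen_exp l x oo degen_log1p l =
      fps_binomial (x / l) oo ((fps_const l * fps_X) oo degen_log1p l)"
    unfolding degen_exp_eq_binomial[OF assms]
    by (rule fps_compose_assoc[symmetric]) (simp_all add: degen_log1p_nth_0)
  also have "(fps_const l * fps_X) oo degen_log1p l = fps_binomial l - 1"
    using assms
    by (simp add: fps_compose_mult_distrib degen_log1p_nth_0)
      (simp add: degen_log1p_def mult.assoc[symmetric])
  finally show ?thesis
    using assms by (simp add: fps_binomial_compose_binomial)
qed

lemma degen_log1p_compose_exp:
  assumes "l \<noteq> 0"
  shows "degen_log1p l oo (degen_exp l 1 - 1) = fps_X"
proof -
  have "fps_binomial l oo (degen_exp l 1 - 1) =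
      fps_binomial l oo ((fps_binomial (1 / l) - 1) oo (fps_const l * fps_X))"
    by (simp add: degen_exp_eq_binomial[OF assms] fps_compose_sub_distrib)
  \<comment> \<open>Regrouping exposes the power law with exponents \<open>l\<close> and
    \<open>1 / l\<close>, whose product 1 leaves the linear series \<open>1 + fps_X\<close>.\<close>
  also have "\<dots> = (fps_binomial l oo (fps_binomial (1 / l) - 1)) oo (fps_const l * fps_X)"
    by (rule fps_compose_assoc) simp_all
  also have "\<dots> = 1 + fps_const l * fps_X"
    using assms
    by (simp add: fps_binomial_compose_binomial fps_binomial_1 fps_compose_add_distrib)
  finally show ?thesis
    using assms
    by (simp add: degen_log1p_def fps_compose_mult_distrib fps_compose_sub_distrib
        degen_exp_nth_0 mult.assoc[symmetric])
qed

lemma Gaenari_egf_compose_exp: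
  assumes "l \<noteq> 0"
  shows "(degen_exp l x oo (degen_log1p l oo degen_log1p l)) oo (degen_exp l 1 - 1) =
    fps_binomial x"
proof -
  let ?L = "degen_log1p l" and ?E = "degen_exp l 1 - 1"
  have "(degen_exp l x oo (?L oo ?L)) oo ?E = degen_exp l x oo ((?L oo ?L) oo ?E)"
    by (rule fps_compose_assoc[symmetric]) (simp_all add: degen_log1p_nth_0 degen_exp_nth_0)
  also have "(?L oo ?L) oo ?E = ?L oo (?L oo ?E)"
    by (rule fps_compose_assoc[symmetric]) (simp_all add: degen_log1p_nth_0 degen_exp_nth_0)
  finally show ?thesis
    by (simp add: degen_log1p_compose_exp degen_exp_compose_log1p assms)
qed

lemma falling_fact_eq_sum_Gaenari_poly:
  assumes "l \<noteq> 0"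
  shows "falling_fact x n = (\<Sum>m=0..n. Gaenari_poly l m x * degen_Stirling2 l n m)"
proof -
  let ?E = "degen_exp l 1 - 1"
  have "falling_fact x n = fact n * fps_nth (fps_binomial x) n"
    by (simp add: falling_fact_def gbinomial_prod_rev lessThan_atLeast0)
  also have "\<dots> = fact n *
      (\<Sum>m=0..n. Gaenari_poly l m x / fact m * fps_nth (?E ^ m) n)"
    by (simp only: Gaenari_egf_compose_exp[OF assms, symmetric] fps_compose_nth
        Gaenari_poly_egf fps_nth_Abs_fps)
  \<comment> \<open>The \<open>1 / fact m\<close> of the outer series is the normalization in
    \<open>degen_Stirling2\<close>.\<close>
  also have "\<dots> = (\<Sum>m=0..n. Gaenari_poly l m x * degen_Stirling2 l n m)"
    by (simp add: degen_Stirling2_def sum_distrib_left mult_ac)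
  finally show ?thesis .
qed

theorem theorem12:
  fixes l x :: real and n :: nat
  assumes "l \<noteq> 0"
  shows "falling_fact x n = (\<Sum>m=0..n. Gaenari_poly l m x * degen_Stirling2 l n m) \<and>
    falling_fact 1 n = (\<Sum>m=0..n. Gaenari_number l m * degen_Stirling2 l n m)"
  unfolding Gaenari_number_def using falling_fact_eq_sum_Gaenari_poly[OF assms] by blast

end
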